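(* The following statements are true: (i) there is no $l_0$-Luzin set; (ii) there is no $cl_0$-Luzin set; (iii) there is no $m_0$-Luzin set. Here Luzin sets are subsets of the Baire space $\omega^\omega$.
   Context: For $\mathcal{I}\subseteq P(\omega^\omega)$, a set $L\subseteq\omega^\omega$ is an $\mathcal{I}$-Luzin set if $|A\cap L|<|L|$ for every $A\in\mathcal{I}$. A tree on $\omega$ is a nonempty set $T\subseteq\omega^{<\omega}$ closed under initial segments; $[T]=\{x\in\omega^\omega:(\forall n)\ x\restriction n\in T\}$ is its body; for $t\in T$, $succ(t)=\{a\in\omega: t^\frown a\in T\}$; $stem(T)$ is the node $\tau\in T$ such that $|succ(\tau)|>1$ and $|succ(s)|=1$ for each $s\subsetneq\tau$. $T$ is a Miller tree, $T\in\mathbb{M}$, if every $s\in T$ has an extension $t\in T$, $s\subseteq t$, with $|succ(t)|=\aleph_0$; a Laver tree, $T\in\mathbb{L}$, if $|succ(t)|=\aleph_0$ for every $t\in T$ with $t\supseteq stem(T)$; a complete Laver tree, $T\in\mathbb{CL}$, if $T$ is a Laver tree with $stem(T)=\emptyset$. For a family of trees $\mathbb{T}$, $t_0$ is the collection of all $A\subseteq\omega^\omega$ such that for every $P\in\mathbb{T}$ there is $Q\in\mathbb{T}$ with $Q\subseteq P$ and $[Q]\cap A=\emptyset$. The collections $m_0,l_0,cl_0$ correspond to $\mathbb{T}=\mathbb{M},\mathbb{L},\mathbb{CL}$ respectively. *)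

theory Defs
  imports "HOL-Library.Sublist" "HOL-Library.Equipollence"
begin

type_synonym baire = "nat \<Rightarrow> nat"
type_synonym nodes = "nat list set"

definition is_tree :: "nodes \<Rightarrow> bool" where
  "is_tree T \<longleftrightarrow> T \<noteq> {} \<and> (\<forall>t\<in>T. \<forall>s. prefix s t \<longrightarrow> s \<in> T)"

definition restr :: "baire \<Rightarrow> nat \<Rightarrow> nat list" where
  "restr x n = map x [0..<n]"

definition body :: "nodes \<Rightarrow> baire set" where
  "body T = {x. \<forall>n. restr x n \<in> T}"

definition succs :: "nodes \<Rightarrow> nat list \<Rightarrow> nat set" where
  "succs T t = {a. t @ [a] \<in> T}"

(* "More than one successor" is not written with card, which is 0 on infinite sets. *)
definition is_stem :: "nodes \<Rightarrow> nat list \<Rightarrow> bool" where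
  "is_stem T u \<longleftrightarrow> u \<in> T
     \<and> (\<exists>a\<in>succs T u. \<exists>b\<in>succs T u. a \<noteq> b)
     \<and> (\<forall>s. strict_prefix s u \<longrightarrow> is_singleton (succs T s))"

(* For sets of natural numbers, cardinality aleph-zero means infinite. *)
definition miller_trees :: "nodes set" where
  "miller_trees = {T. is_tree T \<and> (\<forall>s\<in>T. \<exists>t\<in>T. prefix s t \<and> infinite (succs T t))}"

(* A stem is unique when it exists; a tree without a stem is not a Laver tree. *)
definition laver_trees :: "nodes set" where
  "laver_trees = {T. is_tree T \<and>
     (\<exists>u. is_stem T u \<and> (\<forall>t\<in>T. prefix u t \<longrightarrow> infinite (succs T t)))}"

definition complete_laver_trees :: "nodes set" where
  "complete_laver_trees = {T \<in> laver_trees. is_stem T []}"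

definition tree_null :: "nodes set \<Rightarrow> baire set set" where
  "tree_null \<T> = {A. \<forall>P\<in>\<T>. \<exists>Q\<in>\<T>. Q \<subseteq> P \<and> body Q \<inter> A = {}}"

definition m0 :: "baire set set" where "m0 = tree_null miller_trees"
definition l0 :: "baire set set" where "l0 = tree_null laver_trees"
definition cl0 :: "baire set set" where "cl0 = tree_null complete_laver_trees"

definition luzin_set :: "baire set set \<Rightarrow> baire set \<Rightarrow> bool" where
  "luzin_set \<I> L \<longleftrightarrow> (\<forall>A\<in>\<I>. A \<inter> L \<prec> L)"

end

theory Submission
  imports Defs
begin

text \<open>
Every subset of the Baire space has at most continuum many points. It therefore suffices to find, in
each set \<open>L\<close> outside one of the ideals, a subset \<open>A\<close> in the ideal with continuum many points: then
\<open>A \<inter> L\<close> is as large as \<open>L\<close>. A set \<open>L\<close> in the ideal is no Luzin set, since \<open>L \<inter> L\<close> is not smaller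
than \<open>L\<close>.

Such a subset is built by a diagonalisation of length continuum (\<open>exists_large_null_subset\<close>). Below a
suitable tree \<open>P\<close> one fixes continuum many trees with disjoint bodies \<open>F z\<close>, \<open>z \<in> 2\<^sup>\<omega>\<close>, and picks
\<open>x z \<in> F z \<inter> L\<close>. The difficulty is that a tree may meet every \<open>F z\<close> in many points, so that the
trees handled earlier could cover all of \<open>F z \<inter> L\<close>, even if they are few. This is excluded by a
weak form of the fact that a real added by Miller or Laver forcing has minimal degree: any continuous
function into \<open>2\<^sup>\<omega>\<close> on the branches of a tree becomes injective after thinning the tree, except for
points with countably many values (\<open>injective_off_countable\<close>). Applied to the function that
sends the points of \<open>F z\<close> to \<open>z\<close>, it leaves at most one point in almost every \<open>F z\<close>.

The function is made injective by labelling the nodes \<open>t\<close> with points \<open>Y t\<close> of \<open>2\<^sup>\<omega>\<close>, so that the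
label of a node is the limit, along an ultrafilter, of the labels of its successors
(\<open>exists_limit_labels\<close>), and then thinning the tree so that the places where labels first change
along an edge are all different (\<open>limits_determine_branches\<close>).

The three kinds of trees are treated together. Every Miller, Laver or complete Laver tree contains a
copy of the full tree, inside which all complete Laver trees are copied to trees of the given
kind (\<open>contains_images\<close>). So trees have to be constructed only in the full tree.
\<close>

section \<open>Initial segments of sequences\<close>

lemma length_restr [simp]: "length (restr x n) = n"
  by (simp add: restr_def)

lemma nth_restr [simp]: "i < n \<Longrightarrow> restr x n ! i = x i"
  by (simp add: restr_def)

lemma restr_Suc: "restr x (Suc n) = restr x n @ [x n]"
  by (simp add: restr_def)

lemma take_restr [simp]: "take m (restr x n) = restr x (min m n)"
  by (rule nth_equalityI) auto

lemma restr_mono_agree: "restr x n = restr y n \<Longrightarrow> m \<le> n \<Longrightarrow> restr x m = restr y m"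
  by (metis min.absorb1 take_restr)

lemma restr_eq_nth: "restr x n = restr y n \<Longrightarrow> m < n \<Longrightarrow> x m = y m"
  by (metis nth_restr)

definition initial :: "nat list \<Rightarrow> baire \<Rightarrow> bool" where
  "initial s x \<longleftrightarrow> restr x (length s) = s"

lemma initial_restr [simp]: "initial (restr x n) x"
  by (simp add: initial_def)

lemma initial_prefix: "initial t x \<Longrightarrow> prefix s t \<Longrightarrow> initial s x"
  unfolding initial_def by (metis append_eq_conv_conj min.absorb1 prefix_def prefix_length_le take_restr)

lemma initial_comparable:
  "initial s x \<Longrightarrow> initial t x \<Longrightarrow> length s \<le> length t \<Longrightarrow> prefix s t"
  unfolding initial_def by (metis min.absorb1 take_is_prefix take_restr)

lemma initial_nth: "initial s x \<Longrightarrow> i < length s \<Longrightarrow> x i = s ! i"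
  unfolding initial_def by (metis nth_restr)

lemma infinite_two_elements:
  assumes "infinite A"
  shows "\<exists>a\<in>A. \<exists>b\<in>A. a \<noteq> b"
proof -
  obtain a where "a \<in> A" using infinite_imp_nonempty[OF assms] by blast
  moreover have "infinite (A - {a})" using assms by simp
  then obtain b where "b \<in> A - {a}" using infinite_imp_nonempty by blast
  ultimately show ?thesis by blast
qed

text \<open>
A longer stem would make the root non-branching, so both stems in the definition are empty and the
Laver condition speaks of all nodes.
\<close>
lemma complete_laver_iff:
  "T \<in> complete_laver_trees \<longleftrightarrow> is_tree T \<and> (\<forall>t\<in>T. infinite (succs T t))"
proof
  assume T: "T \<in> complete_laver_trees"
  then obtain u where u: "is_tree T" "is_stem T u" "is_stem T []"
    and inf: "\<forall>t\<in>T. prefix u t \<longrightarrow> infinite (succs T t)"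
    unfolding complete_laver_trees_def laver_trees_def by blast
  have "u = []"
  proof (rule ccontr)
    assume "u \<noteq> []"
    then have "is_singleton (succs T [])"
      using u(2) unfolding is_stem_def by (simp add: strict_prefix_def)
    then show False
      using u(3) unfolding is_stem_def is_singleton_def by auto
  qed
  with u inf show "is_tree T \<and> (\<forall>t\<in>T. infinite (succs T t))" by simp
next
  assume T: "is_tree T \<and> (\<forall>t\<in>T. infinite (succs T t))"
  then have nil: "[] \<in> T" unfolding is_tree_def by auto
  then have "infinite (succs T [])" using T by blast
  then have "\<exists>a\<in>succs T []. \<exists>b\<in>succs T []. a \<noteq> b"
    by (rule infinite_two_elements)
  then have "is_stem T []" using nil unfolding is_stem_def by auto
  then show "T \<in> complete_laver_trees"
    using T unfolding complete_laver_trees_def laver_trees_def by auto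
qed

section \<open>Copies of the full tree inside a tree\<close>

text \<open>
The edge \<open>a\<close> above \<open>t\<close> is sent to the edge \<open>e t a\<close> directly above \<open>\<phi> t\<close>: branching
nodes go to branching nodes. After that edge the image may run on without branching, which is what
a Miller tree forces; for Laver trees both sides of \<open>prefix\<close> below will be equal.
\<close>
definition tree_embedding :: "(nat list \<Rightarrow> nat list) \<Rightarrow> (nat list \<Rightarrow> nat \<Rightarrow> nat) \<Rightarrow> bool" where
  "tree_embedding \<phi> e \<longleftrightarrow> (\<forall>t. inj (e t)) \<and> (\<forall>t a. prefix (\<phi> t @ [e t a]) (\<phi> (t @ [a])))"

definition image_tree :: "(nat list \<Rightarrow> nat list) \<Rightarrow> nodes \<Rightarrow> nodes" where
  "image_tree \<phi> Q = {s. \<exists>t\<in>Q. prefix s (\<phi> t)}"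

text \<open>
Since \<open>\<phi>\<close> lengthens nodes, entry \<open>n\<close> of the image branch is already fixed by
\<open>restr x (Suc n)\<close>.
\<close>
definition branch_map :: "(nat list \<Rightarrow> nat list) \<Rightarrow> baire \<Rightarrow> baire" where
  "branch_map \<phi> x = (\<lambda>n. \<phi> (restr x (Suc n)) ! n)"

lemma tree_embedding_mono:
  assumes "tree_embedding \<phi> e" "prefix s t"
  shows "prefix (\<phi> s) (\<phi> t)"
proof -
  have "prefix (\<phi> s) (\<phi> (s @ r))" for r
  proof (induction r rule: rev_induct)
    case (snoc a r)
    then show ?case
      using assms(1) unfolding tree_embedding_def
      by (metis append.assoc append_prefixD prefix_order.trans)
  qed simp
  then show ?thesis using assms(2) by (auto simp: prefix_def)
qed

lemma tree_embedding_length: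
  assumes "tree_embedding \<phi> e"
  shows "length t \<le> length (\<phi> t)"
proof (induction t rule: rev_induct)
  case (snoc a t)
  have "prefix (\<phi> t @ [e t a]) (\<phi> (t @ [a]))"
    using assms unfolding tree_embedding_def by blast
  from prefix_length_le[OF this] snoc show ?case by simp
qed simp

text \<open>
Two different nodes of the same length first disagree on some edge, and injectivity of \<open>e\<close> sends
the two edges to different edges at one node; so their images cannot lie on a common branch.
\<close>
lemma tree_embedding_inj:
  assumes E: "tree_embedding \<phi> e"
  shows "length s = length t \<Longrightarrow> initial (\<phi> s) z \<Longrightarrow> initial (\<phi> t) z \<Longrightarrow> s = t"
proof (induction s arbitrary: t rule: rev_induct)
  case (snoc a s)
  obtain b t' where t: "t = t' @ [b]"
    using snoc.prems(1) by (metis length_0_conv rev_exhaust length_append_singleton nat.distinct(1))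
  have pa: "prefix (\<phi> s @ [e s a]) (\<phi> (s @ [a]))" and pb: "prefix (\<phi> t' @ [e t' b]) (\<phi> t)"
    using E t unfolding tree_embedding_def by auto
  have ia: "initial (\<phi> s @ [e s a]) z" and ib: "initial (\<phi> t' @ [e t' b]) z"
    using snoc.prems pa pb initial_prefix by blast+
  then have "initial (\<phi> s) z" "initial (\<phi> t') z"
    by (meson initial_prefix prefixI)+
  then have st: "s = t'" using snoc.IH[of t'] snoc.prems(1) t by simp
  have "e s a = e s b"
    using initial_nth[OF ia, of "length (\<phi> s)"] initial_nth[OF ib, of "length (\<phi> s)"] st by simp
  then have "a = b" using E unfolding tree_embedding_def by (metis injD)
  then show ?case using st t by simp
qed simp

lemma tree_embedding_reflects_prefix:
  assumes E: "tree_embedding \<phi> e"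
    and p: "prefix (\<phi> t) (\<phi> s)" and len: "length (\<phi> t) < length (\<phi> s)"
  shows "prefix t s"
proof -
  define w where "w i = (if i < length (\<phi> s) then \<phi> s ! i else 0)" for i
  have w: "initial (\<phi> s) w"
    unfolding initial_def w_def by (rule nth_equalityI) auto
  show ?thesis
  proof (cases "length t \<le> length s")
    case True
    have "initial (\<phi> t) w" using w p initial_prefix by blast
    moreover have "initial (\<phi> (take (length t) s)) w"
      using w tree_embedding_mono[OF E take_is_prefix] initial_prefix by blast
    ultimately have "t = take (length t) s" using tree_embedding_inj[OF E] True by simp
    then show ?thesis by (metis take_is_prefix)
  next
    case False
    have "initial (\<phi> (take (length s) t)) w"
      using w p tree_embedding_mono[OF E take_is_prefix] initial_prefix prefix_order.trans by blast
    then have "s = take (length s) t" using tree_embedding_inj[OF E _ w] False by simp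
    then have "prefix (\<phi> s) (\<phi> t)" using tree_embedding_mono[OF E] by (metis take_is_prefix)
    then show ?thesis using prefix_length_le len by fastforce
  qed
qed

lemma initial_branch_map:
  assumes E: "tree_embedding \<phi> e"
  shows "initial (\<phi> (restr x k)) (branch_map \<phi> x)"
proof -
  have "branch_map \<phi> x i = \<phi> (restr x k) ! i" if i: "i < length (\<phi> (restr x k))" for i
  proof -
    have l: "i < length (\<phi> (restr x (Suc i)))"
      using tree_embedding_length[OF E, of "restr x (Suc i)"] by simp
    have "prefix (restr x (Suc i)) (restr x k) \<or> prefix (restr x k) (restr x (Suc i))"
      using initial_comparable initial_restr by (metis nat_le_linear)
    then have "prefix (\<phi> (restr x (Suc i))) (\<phi> (restr x k)) \<or> prefix (\<phi> (restr x k)) (\<phi> (restr x (Suc i)))"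
      using tree_embedding_mono[OF E] by blast
    then show ?thesis unfolding branch_map_def using i l
      by (auto simp: prefix_def nth_append)
  qed
  then show ?thesis unfolding initial_def by (intro nth_equalityI) auto
qed

text \<open>
The nodes \<open>\<phi> t\<close> on the image branch are exactly those with \<open>t\<close> on the branch. This is what makes
\<open>branch_map \<phi>\<close> a homeomorphism onto its range.
\<close>
lemma initial_branch_map_iff:
  assumes E: "tree_embedding \<phi> e"
  shows "initial (\<phi> t) (branch_map \<phi> x) \<longleftrightarrow> initial t x"
proof
  assume "initial (\<phi> t) (branch_map \<phi> x)"
  then have "restr x (length t) = t"
    using tree_embedding_inj[OF E _ initial_branch_map[OF E, of x "length t"]] by simp
  then show "initial t x" unfolding initial_def .
next
  assume "initial t x"
  then show "initial (\<phi> t) (branch_map \<phi> x)"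
    using initial_branch_map[OF E, of x "length t"] unfolding initial_def by simp
qed

lemma branch_map_continuous:
  assumes E: "tree_embedding \<phi> e" and "restr x n = restr y n"
  shows "restr (branch_map \<phi> x) n = restr (branch_map \<phi> y) n"
proof (rule nth_equalityI)
  fix i assume "i < length (restr (branch_map \<phi> x) n)"
  then have i: "i < n" by simp
  then have "restr x (Suc i) = restr y (Suc i)" using assms(2) restr_mono_agree by (metis Suc_leI)
  then show "restr (branch_map \<phi> x) n ! i = restr (branch_map \<phi> y) n ! i"
    using i unfolding branch_map_def by simp
qed simp

lemma inj_branch_map:
  assumes E: "tree_embedding \<phi> e"
  shows "inj (branch_map \<phi>)"
proof (rule injI, rule ext)
  fix x y n assume eq: "branch_map \<phi> x = branch_map \<phi> y"
  have "initial (restr x (Suc n)) y"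
    using initial_branch_map[OF E, of x "Suc n"] initial_branch_map_iff[OF E] eq by metis
  then show "x n = y n" using initial_nth[of "restr x (Suc n)" y n] by simp
qed

lemma is_tree_image_tree: "is_tree Q \<Longrightarrow> is_tree (image_tree \<phi> Q)"
  unfolding is_tree_def image_tree_def by (auto intro: prefix_order.trans)

text \<open>
A branch \<open>z\<close> through the image is climbed one node at a time: given \<open>\<phi> t\<close> on \<open>z\<close>, the tree must
continue through \<open>\<phi> t @ [z (length (\<phi> t))]\<close>, and injectivity of \<open>e t\<close> names the one edge \<open>a\<close>
above \<open>t\<close> responsible for this, whatever longer piece of \<open>z\<close> is looked at. Hence the whole of
\<open>\<phi> (t @ [a])\<close> lies on \<open>z\<close>.
\<close>
lemma body_image_tree:
  assumes E: "tree_embedding \<phi> e" and Q: "is_tree Q"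
  shows "body (image_tree \<phi> Q) \<subseteq> branch_map \<phi> ` body Q"
proof
  fix z assume z: "z \<in> body (image_tree \<phi> Q)"
  have "\<exists>t\<in>Q. length t = k \<and> initial (\<phi> t) z" for k
  proof (induction k)
    case 0
    have "initial (\<phi> []) z"
    proof -
      obtain s where "s \<in> Q" "prefix (restr z (length (\<phi> []))) (\<phi> s)"
        using z unfolding body_def image_tree_def by blast
      moreover have "prefix (\<phi> []) (\<phi> s)" using tree_embedding_mono[OF E] by simp
      ultimately show ?thesis unfolding initial_def
        by (metis length_restr prefix_length_prefix prefix_order.antisym order_refl)
    qed
    then show ?case using Q unfolding is_tree_def by (metis Nil_prefix ex_in_conv length_0_conv)
  next
    case (Suc k)
    then obtain t where t: "t \<in> Q" "length t = k" "initial (\<phi> t) z" by blast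
    have step: "\<exists>a. t @ [a] \<in> Q \<and> e t a = z (length (\<phi> t)) \<and> prefix (\<phi> (t @ [a])) (\<phi> s)
        \<and> prefix (restr z n) (\<phi> s)"
      if n: "n > length (\<phi> t)" and s: "s \<in> Q" "prefix (restr z n) (\<phi> s)" for n s
    proof -
      have ts: "prefix (\<phi> t) (\<phi> s)" using t(3) n s(2)
        by (metis initial_comparable initial_restr length_restr less_or_eq_imp_le prefix_order.trans)
      have ns: "n \<le> length (\<phi> s)" using prefix_length_le[OF s(2)] by simp
      then have "length (\<phi> t) < length (\<phi> s)" using n by simp
      then have "prefix t s" "t \<noteq> s" using tree_embedding_reflects_prefix[OF E ts] by auto
      then obtain a r where r: "s = t @ [a] @ r"
        by (metis append_Cons append_Nil neq_Nil_conv prefix_def self_append_conv)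
      have as: "prefix (t @ [a]) s" using r by simp
      have "t @ [a] \<in> Q" using Q s(1) as unfolding is_tree_def by blast
      moreover have pas: "prefix (\<phi> (t @ [a])) (\<phi> s)" using tree_embedding_mono[OF E as] .
      moreover have "e t a = z (length (\<phi> t))"
      proof -
        have "prefix (\<phi> t @ [e t a]) (\<phi> s)"
          using E pas prefix_order.trans unfolding tree_embedding_def by blast
        then have "\<phi> s ! length (\<phi> t) = e t a" by (auto simp: prefix_def nth_append)
        moreover have "\<phi> s ! length (\<phi> t) = restr z n ! length (\<phi> t)"
          using s(2) n by (auto simp: prefix_def nth_append)
        ultimately show ?thesis using n by simp
      qed
      ultimately show ?thesis using s(2) by blast
    qed
    have ex: "\<exists>s\<in>Q. prefix (restr z n) (\<phi> s)" for n
      using z unfolding body_def image_tree_def by blast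
    obtain a where a: "t @ [a] \<in> Q" "e t a = z (length (\<phi> t))"
      using step[of "Suc (length (\<phi> t))"] ex by blast
    \<comment> \<open>long enough for the piece of \<open>z\<close> to cover \<open>\<phi> (t @ [a])\<close> completely\<close>
    define n where "n = Suc (length (\<phi> t) + length (\<phi> (t @ [a])))"
    obtain s where s: "s \<in> Q" "prefix (restr z n) (\<phi> s)" using ex by blast
    obtain b where b: "e t b = z (length (\<phi> t))" "prefix (\<phi> (t @ [b])) (\<phi> s)"
      using step[of n s] s unfolding n_def by auto
    have "b = a" using a(2) b(1) E unfolding tree_embedding_def by (metis injD)
    then have "prefix (\<phi> (t @ [a])) (restr z n)"
      using prefix_length_prefix[OF b(2)[unfolded \<open>b = a\<close>] s(2)] unfolding n_def by simp
    then have "initial (\<phi> (t @ [a])) z" by (meson initial_prefix initial_restr)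
    then show ?case using a(1) t(2) by (metis length_append_singleton)
  qed
  then obtain t where t: "\<And>k. t k \<in> Q" "\<And>k. length (t k) = k" "\<And>k. initial (\<phi> (t k)) z"
    by metis
  define x where "x n = t (Suc n) ! n" for n
  have coh: "take j (t k) = t j" if "j \<le> k" for j k
  proof (rule tree_embedding_inj[OF E])
    show "length (take j (t k)) = length (t j)" using that t(2) by simp
    show "initial (\<phi> (take j (t k))) z"
      using tree_embedding_mono[OF E take_is_prefix] initial_prefix t(3) by blast
  qed (rule t(3))
  have x: "restr x k = t k" for k
  proof (rule nth_equalityI)
    fix i assume "i < length (restr x k)"
    then have "i < k" by simp
    then show "restr x k ! i = t k ! i"
      using coh[of "Suc i" k] unfolding x_def by (metis Suc_leI lessI nth_restr nth_take x_def)
  qed (simp add: t(2))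
  have "branch_map \<phi> x = z"
  proof
    fix n
    have "initial (\<phi> (restr x (Suc n))) z" using t(3) x by simp
    moreover have "n < length (\<phi> (restr x (Suc n)))"
      using tree_embedding_length[OF E, of "restr x (Suc n)"] by simp
    ultimately show "branch_map \<phi> x n = z n" unfolding branch_map_def using initial_nth by metis
  qed
  moreover have "x \<in> body Q" unfolding body_def using x t(1) by simp
  ultimately show "z \<in> branch_map \<phi> ` body Q" by blast
qed

lemma infinite_succs_image_tree:
  assumes E: "tree_embedding \<phi> e" and t: "infinite (succs Q t)"
  shows "infinite (succs (image_tree \<phi> Q) (\<phi> t))"
proof -
  have "e t ` succs Q t \<subseteq> succs (image_tree \<phi> Q) (\<phi> t)"
    using E unfolding succs_def image_tree_def tree_embedding_def by blast
  moreover have "inj_on (e t) (succs Q t)"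
    using E unfolding tree_embedding_def by (meson inj_on_subset subset_UNIV)
  ultimately show ?thesis using t finite_subset finite_imageD by blast
qed

text \<open>
Embeddings are built by recursion along a set \<open>N\<close> of infinitely splitting nodes: edge number \<open>i\<close>
above \<open>t\<close> is sent to the \<open>i\<close>-th edge available in \<open>P\<close>, followed by the walk \<open>h\<close> to the next node
of \<open>N\<close>.
\<close>
lemma exists_tree_embedding:
  assumes r: "r \<in> N"
    and inf: "\<And>s. s \<in> N \<Longrightarrow> infinite (succs P s)"
    and h: "\<And>s a. s \<in> N \<Longrightarrow> a \<in> succs P s \<Longrightarrow> h s a \<in> N \<and> prefix (s @ [a]) (h s a)"
  obtains \<phi> e where "tree_embedding \<phi> e" "\<phi> [] = r" "\<And>t. \<phi> t \<in> N"
    "\<And>t a. \<phi> (t @ [a]) = h (\<phi> t) (e t a)"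
proof
  define \<phi> where "\<phi> = foldl (\<lambda>s i. h s (enumerate (succs P s) i)) r"
  define e where "e t = enumerate (succs P (\<phi> t))" for t
  show snoc: "\<phi> (t @ [a]) = h (\<phi> t) (e t a)" for t a unfolding \<phi>_def e_def by simp
  show N: "\<phi> t \<in> N" for t
  proof (induction t rule: rev_induct)
    case Nil show ?case using r unfolding \<phi>_def by simp
  next
    case (snoc a t)
    then show ?case unfolding \<open>\<phi> (t @ [a]) = h (\<phi> t) (e t a)\<close> e_def using h inf enumerate_in_set by blast
  qed
  show "\<phi> [] = r" unfolding \<phi>_def by simp
  show "tree_embedding \<phi> e" unfolding tree_embedding_def
    using N h inf snoc by (metis e_def enumerate_in_set strict_mono_enumerate strict_mono_imp_inj_on)
qed

text \<open>
The only property of the families of Miller, Laver and complete Laver trees that the main argument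
uses: below each member sits a copy of \<open>\<omega>\<^bsup><\<omega>\<^esup>\<close> in which every complete Laver tree is copied to a
member.
\<close>
definition contains_images :: "nodes set \<Rightarrow> bool" where
  "contains_images \<T> \<longleftrightarrow> (\<forall>P\<in>\<T>. \<exists>\<phi> e. tree_embedding \<phi> e \<and>
     (\<forall>Q\<in>complete_laver_trees. image_tree \<phi> Q \<in> \<T> \<and> image_tree \<phi> Q \<subseteq> P))"

lemma image_tree_subset:
  assumes "is_tree P" "\<And>t. \<phi> t \<in> P"
  shows "image_tree \<phi> Q \<subseteq> P"
  using assms unfolding is_tree_def image_tree_def by blast

lemma contains_images_miller: "contains_images miller_trees"
  unfolding contains_images_def
proof
  fix P assume "P \<in> miller_trees"
  then have tree: "is_tree P" and split: "\<And>s. s \<in> P \<Longrightarrow> \<exists>t\<in>P. prefix s t \<and> infinite (succs P t)"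
    unfolding miller_trees_def by auto
  define N where "N = {s \<in> P. infinite (succs P s)}"
  define h where "h s a = (SOME t. t \<in> N \<and> prefix (s @ [a]) t)" for s a
  obtain s where "s \<in> P" using tree unfolding is_tree_def by blast
  then obtain r where r: "r \<in> N" using split[of s] unfolding N_def by blast
  have h: "h s a \<in> N \<and> prefix (s @ [a]) (h s a)" if "s \<in> N" "a \<in> succs P s" for s a
    unfolding h_def using split[of "s @ [a]"] that(2)
    by (intro someI_ex[of "\<lambda>t. t \<in> N \<and> prefix (s @ [a]) t"]) (auto simp: N_def succs_def)
  obtain \<phi> e where E: "tree_embedding \<phi> e" and N: "\<And>t. \<phi> t \<in> N"
    using exists_tree_embedding[of r N P h] r h unfolding N_def by blast
  have "image_tree \<phi> Q \<in> miller_trees \<and> image_tree \<phi> Q \<subseteq> P" if Q: "Q \<in> complete_laver_trees" for Q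
  proof -
    have Q': "is_tree Q" "\<And>t. t \<in> Q \<Longrightarrow> infinite (succs Q t)"
      using Q complete_laver_iff by auto
    have "\<exists>t\<in>image_tree \<phi> Q. prefix s t \<and> infinite (succs (image_tree \<phi> Q) t)"
      if s: "s \<in> image_tree \<phi> Q" for s
    proof -
      obtain t where "t \<in> Q" "prefix s (\<phi> t)" using s unfolding image_tree_def by blast
      moreover from this have "\<phi> t \<in> image_tree \<phi> Q" unfolding image_tree_def by blast
      ultimately show ?thesis using infinite_succs_image_tree[OF E Q'(2)] by blast
    qed
    then show ?thesis
      using is_tree_image_tree[OF Q'(1)] image_tree_subset[OF tree] N
      unfolding miller_trees_def N_def by blast
  qed
  then show "\<exists>\<phi> e. tree_embedding \<phi> e \<and>
     (\<forall>Q\<in>complete_laver_trees. image_tree \<phi> Q \<in> miller_trees \<and> image_tree \<phi> Q \<subseteq> P)"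
    using E by blast
qed

text \<open>
When no edge is prolonged, every node of the image above \<open>\<phi> []\<close> is itself some \<open>\<phi> t\<close> and splits
infinitely, while the nodes below \<open>\<phi> []\<close> have a single successor; so \<open>\<phi> []\<close> is the stem.
\<close>
lemma laver_image_tree:
  assumes E: "tree_embedding \<phi> e" and step: "\<And>t a. \<phi> (t @ [a]) = \<phi> t @ [e t a]"
    and Q: "Q \<in> complete_laver_trees"
  shows "image_tree \<phi> Q \<in> laver_trees \<and> is_stem (image_tree \<phi> Q) (\<phi> [])"
proof -
  let ?T = "image_tree \<phi> Q"
  have tree: "is_tree Q" and inf: "\<And>t. t \<in> Q \<Longrightarrow> infinite (succs Q t)"
    using Q complete_laver_iff by auto
  have len: "length (\<phi> t) = length (\<phi> []) + length t" for t
    by (induction t rule: rev_induct) (auto simp: step)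
  have nil: "[] \<in> Q" using tree unfolding is_tree_def by auto
  have root: "prefix (\<phi> []) (\<phi> t)" for t using tree_embedding_mono[OF E] by simp
  have above: "infinite (succs ?T s)" if s: "s \<in> ?T" "prefix (\<phi> []) s" for s
  proof -
    obtain t where t: "t \<in> Q" "prefix s (\<phi> t)" using s unfolding image_tree_def by blast
    define t' where "t' = take (length s - length (\<phi> [])) t"
    have "length (\<phi> t') = length s"
      using len[of t'] len[of t] prefix_length_le[OF t(2)] prefix_length_le[OF s(2)]
      unfolding t'_def by simp
    moreover have "prefix (\<phi> t') (\<phi> t)"
      using tree_embedding_mono[OF E] unfolding t'_def by (metis take_is_prefix)
    ultimately have "s = \<phi> t'" using t(2) by (metis order_refl prefix_length_prefix prefix_order.antisym)
    moreover have "t' \<in> Q" using tree t(1) unfolding is_tree_def t'_def by (meson take_is_prefix)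
    ultimately show ?thesis using infinite_succs_image_tree[OF E inf] by simp
  qed
  have root_in: "\<phi> [] \<in> ?T" using nil unfolding image_tree_def by blast
  have "is_stem ?T (\<phi> [])" unfolding is_stem_def
  proof (intro conjI allI impI)
    have "infinite (succs ?T (\<phi> []))" using above root_in by simp
    then show "\<exists>a\<in>succs ?T (\<phi> []). \<exists>b\<in>succs ?T (\<phi> []). a \<noteq> b"
      by (rule infinite_two_elements)
    fix s assume s: "strict_prefix s (\<phi> [])"
    then obtain a r where "\<phi> [] = s @ a # r" by (rule strict_prefixE')
    then have a: "prefix (s @ [a]) (\<phi> [])" by simp
    have "succs ?T s = {a}"
    proof
      show "succs ?T s \<subseteq> {a}"
      proof
        fix b assume "b \<in> succs ?T s"
        then obtain t where "prefix (s @ [b]) (\<phi> t)" unfolding succs_def image_tree_def by blast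
        moreover have "prefix (s @ [a]) (\<phi> t)" using a root prefix_order.trans by blast
        ultimately have "s @ [b] = s @ [a]"
          by (metis length_append_singleton order_refl prefix_length_prefix prefix_order.antisym)
        then show "b \<in> {a}" by simp
      qed
      show "{a} \<subseteq> succs ?T s" using a nil unfolding succs_def image_tree_def by blast
    qed
    then show "is_singleton (succs ?T s)" by simp
  qed (rule root_in)
  then show ?thesis
    using above is_tree_image_tree[OF tree] unfolding laver_trees_def by blast
qed

lemma contains_images_laver: "contains_images laver_trees"
  and contains_images_complete_laver: "contains_images complete_laver_trees"
proof -
  have emb: "\<exists>\<phi> e. tree_embedding \<phi> e \<and> \<phi> [] = u \<and>
     (\<forall>Q\<in>complete_laver_trees. image_tree \<phi> Q \<in> laver_trees
        \<and> is_stem (image_tree \<phi> Q) u \<and> image_tree \<phi> Q \<subseteq> P)"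
    if tree: "is_tree P" and u: "u \<in> P"
      and inf: "\<And>t. t \<in> P \<Longrightarrow> prefix u t \<Longrightarrow> infinite (succs P t)" for P u
  proof -
    define N where "N = {s \<in> P. prefix u s}"
    obtain \<phi> e where E: "tree_embedding \<phi> e" "\<phi> [] = u" and N: "\<And>t. \<phi> t \<in> N"
      and step: "\<And>t a. \<phi> (t @ [a]) = \<phi> t @ [e t a]"
      using exists_tree_embedding[of u N P "\<lambda>s a. s @ [a]"] u inf
      unfolding N_def by (auto simp: succs_def)
    have "image_tree \<phi> Q \<subseteq> P" for Q
      using image_tree_subset[OF tree] N unfolding N_def by blast
    then show ?thesis using laver_image_tree[OF E(1) step] E by metis
  qed
  show "contains_images laver_trees"
    unfolding contains_images_def
  proof
    fix P assume "P \<in> laver_trees"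
    then obtain u where "is_tree P" "u \<in> P" "\<forall>t\<in>P. prefix u t \<longrightarrow> infinite (succs P t)"
      unfolding laver_trees_def is_stem_def by blast
    then show "\<exists>\<phi> e. tree_embedding \<phi> e \<and>
       (\<forall>Q\<in>complete_laver_trees. image_tree \<phi> Q \<in> laver_trees \<and> image_tree \<phi> Q \<subseteq> P)"
      using emb[of P u] by blast
  qed
  show "contains_images complete_laver_trees"
    unfolding contains_images_def
  proof
    fix P assume "P \<in> complete_laver_trees"
    then have "is_tree P" "[] \<in> P" "\<forall>t\<in>P. infinite (succs P t)"
      unfolding complete_laver_iff is_tree_def by auto
    then show "\<exists>\<phi> e. tree_embedding \<phi> e \<and>
       (\<forall>Q\<in>complete_laver_trees. image_tree \<phi> Q \<in> complete_laver_trees \<and> image_tree \<phi> Q \<subseteq> P)"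
      using emb[of P "[]"] by (auto simp: complete_laver_trees_def)
  qed
qed

section \<open>Limits along an ultrafilter\<close>

text \<open>
A maximal family with the property that finite intersections are infinite.
\<close>
lemma exists_free_ultrafilter:
  obtains U :: "nat set set" where "\<And>X. X \<in> U \<Longrightarrow> infinite X" "\<And>X. X \<in> U \<or> - X \<in> U"
    "\<And>X Y. X \<in> U \<Longrightarrow> Y \<in> U \<Longrightarrow> X \<inter> Y \<in> U"
proof -
  define \<A> where "\<A> = {F :: nat set set. \<forall>S\<subseteq>F. finite S \<longrightarrow> infinite (\<Inter>S)}"
  have "\<exists>U\<in>\<A>. \<forall>X\<in>\<A>. U \<subseteq> X \<longrightarrow> X = U"
  proof (rule subset_Zorn_nonempty)
    show "\<A> \<noteq> {}" unfolding \<A>_def by (auto intro!: exI[of _ "{}"])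
    fix \<C> assume ne: "\<C> \<noteq> {}" and ch: "subset.chain \<A> \<C>"
    have "infinite (\<Inter>S)" if "S \<subseteq> \<Union>\<C>" "finite S" for S
    proof -
      have "\<exists>F\<in>\<C>. S \<subseteq> F" using finite_subset_Union_chain[OF that(2,1) ne ch] by blast
      then show ?thesis using ch that(2) unfolding \<A>_def subset.chain_def by blast
    qed
    then show "\<Union>\<C> \<in> \<A>" unfolding \<A>_def by blast
  qed
  then obtain U where U: "U \<in> \<A>" and max: "\<And>X. X \<in> \<A> \<Longrightarrow> U \<subseteq> X \<Longrightarrow> X = U" by blast
  have fip: "infinite (\<Inter>S)" if "S \<subseteq> U" "finite S" for S
    using U that unfolding \<A>_def by blast
  have small: "\<exists>S\<subseteq>U. finite S \<and> finite (X \<inter> \<Inter>S)" if "X \<notin> U" for X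
  proof -
    have "insert X U \<notin> \<A>" using max[of "insert X U"] that by blast
    then obtain S where S: "S \<subseteq> insert X U" "finite S" "finite (\<Inter>S)" unfolding \<A>_def by blast
    have "X \<inter> \<Inter>(S - {X}) \<subseteq> \<Inter>S" by blast
    then have "finite (X \<inter> \<Inter>(S - {X}))" using S(3) finite_subset by blast
    then show ?thesis using S(1,2) by (intro exI[of _ "S - {X}"]) auto
  qed
  have ultra: "X \<in> U \<or> - X \<in> U" for X
  proof (rule ccontr)
    assume "\<not> (X \<in> U \<or> - X \<in> U)"
    then obtain S S' where S: "S \<subseteq> U" "finite S" "finite (X \<inter> \<Inter>S)"
      "S' \<subseteq> U" "finite S'" "finite (- X \<inter> \<Inter>S')" using small by meson
    have "\<Inter>(S \<union> S') \<subseteq> (X \<inter> \<Inter>S) \<union> (- X \<inter> \<Inter>S')" by blast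
    then have "finite (\<Inter>(S \<union> S'))" using S finite_subset by blast
    then show False using fip[of "S \<union> S'"] S by blast
  qed
  have "X \<inter> Y \<in> U" if "X \<in> U" "Y \<in> U" for X Y
  proof (rule ccontr)
    assume "X \<inter> Y \<notin> U"
    then have "{X, Y, - (X \<inter> Y)} \<subseteq> U" using ultra[of "X \<inter> Y"] that by blast
    then have "infinite (\<Inter>{X, Y, - (X \<inter> Y)})" using fip by blast
    moreover have "\<Inter>{X, Y, - (X \<inter> Y)} = {}" by blast
    ultimately show False by simp
  qed
  moreover have "infinite X" if "X \<in> U" for X using fip[of "{X}"] that by simp
  ultimately show ?thesis using that ultra by blast
qed

text \<open>
The nodes from which some strategy, choosing \<open>U\<close>-large sets of successors, leads every branch
into \<open>S\<close>. For an ultrafilter \<open>U\<close>, failure of this at \<open>t\<close> persists at \<open>U\<close>-almost all successors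
of \<open>t\<close>.
\<close>
inductive almost_forced :: "nat set set \<Rightarrow> nodes \<Rightarrow> nat list \<Rightarrow> bool" for U S where
  base: "t \<in> S \<Longrightarrow> almost_forced U S t"
| step: "A \<in> U \<Longrightarrow> (\<And>a. a \<in> A \<Longrightarrow> almost_forced U S (t @ [a])) \<Longrightarrow> almost_forced U S t"

text \<open>
A continuous function into \<open>2\<^sup>\<omega>\<close> is spread over the nodes of the tree: \<open>Y t n\<close> says whether the
value \<open>g x n = True\<close> can almost be forced above \<open>t\<close>. By the ultrafilter dichotomy each bit of
\<open>Y t\<close> is inherited by almost all successors, and by continuity the labels along a branch \<open>x\<close>
converge to \<open>g x\<close>. Only continuity on \<open>X\<close> in the relative topology is assumed, since \<open>g\<close> will be
composed with the inverse of an embedding, which is continuous on a range only.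
\<close>
lemma exists_limit_labels:
  fixes g :: "baire \<Rightarrow> nat \<Rightarrow> bool"
  assumes cont: "\<And>x n. x \<in> X \<Longrightarrow> \<exists>k. \<forall>x'\<in>X. restr x' k = restr x k \<longrightarrow> g x' n = g x n"
  obtains Y :: "nat list \<Rightarrow> nat \<Rightarrow> bool" where
    "\<And>t m. infinite {a. \<forall>n<m. Y (t @ [a]) n = Y t n}"
    "\<And>x n. x \<in> X \<Longrightarrow> \<exists>k. \<forall>j\<ge>k. Y (restr x j) n = g x n"
proof -
  obtain U :: "nat set set" where U: "\<And>A. A \<in> U \<Longrightarrow> infinite A" "\<And>A. A \<in> U \<or> - A \<in> U"
    "\<And>A B. A \<in> U \<Longrightarrow> B \<in> U \<Longrightarrow> A \<inter> B \<in> U" using exists_free_ultrafilter by blast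
  have up: "B \<in> U" if "A \<in> U" "A \<subseteq> B" for A B
  proof (rule ccontr)
    assume "B \<notin> U"
    then have "infinite (A \<inter> - B)" using U that(1) by blast
    moreover have "A \<inter> - B = {}" using that(2) by blast
    ultimately show False by simp
  qed
  have UNIV: "UNIV \<in> U" using U(2) up by blast
  \<comment> \<open>Nodes that miss \<open>X\<close> decide nothing; they inherit the decision of a shorter node that meets \<open>X\<close>,
      so that \<open>S n\<close> is closed under extension.\<close>
  define S where "S n = {t. \<exists>s. prefix s t \<and> (\<exists>x\<in>X. initial s x) \<and> (\<forall>x\<in>X. initial s x \<longrightarrow> g x n)}" for n
  define Y where "Y t n = (almost_forced U (S n) t)" for t n
  have step: "{a. Y (t @ [a]) n = Y t n} \<in> U" for t n
  proof (cases "{a. Y (t @ [a]) n} \<in> U")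
    case True
    then have "Y t n" unfolding Y_def by (rule almost_forced.step) simp
    then show ?thesis using True by simp
  next
    case False
    have "\<not> Y t n"
    proof
      assume "Y t n"
      then show False unfolding Y_def
      proof cases
        case base
        then have "t @ [a] \<in> S n" for a unfolding S_def by auto
        then have "{a. Y (t @ [a]) n} = UNIV" unfolding Y_def by (auto intro: almost_forced.base)
        then show False using False UNIV by simp
      next
        case (step A)
        then have "A \<subseteq> {a. Y (t @ [a]) n}" unfolding Y_def by blast
        then show False using up step(1) False by blast
      qed
    qed
    then have "- {a. Y (t @ [a]) n} = {a. Y (t @ [a]) n = Y t n}" by auto
    then show ?thesis using U(2) False by metis
  qed
  have "{a. \<forall>n<m. Y (t @ [a]) n = Y t n} \<in> U" for t m
  proof (induction m)
    case (Suc m)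
    have "{a. \<forall>n<Suc m. Y (t @ [a]) n = Y t n}
        = {a. \<forall>n<m. Y (t @ [a]) n = Y t n} \<inter> {a. Y (t @ [a]) m = Y t m}"
      by (auto simp: less_Suc_eq)
    then show ?case using U(3)[OF Suc step] by simp
  qed (simp add: UNIV)
  then have "infinite {a. \<forall>n<m. Y (t @ [a]) n = Y t n}" for t m using U(1) by blast
  moreover have "\<exists>k. \<forall>j\<ge>k. Y (restr x j) n = g x n" if x: "x \<in> X" for x n
  proof -
    obtain k where k: "\<And>x'. x' \<in> X \<Longrightarrow> restr x' k = restr x k \<Longrightarrow> g x' n = g x n"
      using cont[OF x] by blast
    have "Y (restr x j) n = g x n" if j: "j \<ge> k" for j
    proof (cases "g x n")
      case True
      have "prefix (restr x k) (restr x j)" using j by (metis initial_comparable initial_restr length_restr)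
      then have "restr x j \<in> S n" unfolding S_def using x k True
        by (auto intro!: exI[of _ "restr x k"] bexI[of _ x] simp: initial_def)
      then show ?thesis unfolding Y_def using True by (auto intro: almost_forced.base)
    next
      case False
      have "\<not> prefix (restr x k) t" if "almost_forced U (S n) t" for t
        using that
      proof induction
        case (base t)
        show ?case
        proof
          assume p: "prefix (restr x k) t"
          obtain s y where s: "prefix s t" "y \<in> X" "initial s y" "\<forall>x\<in>X. initial s x \<longrightarrow> g x n"
            using base unfolding S_def by blast
          have "\<not> initial s x" using s(4) x False by blast
          then have "\<not> prefix s (restr x k)" by (meson initial_prefix initial_restr)
          then have "prefix (restr x k) s" using p s(1) prefix_same_cases by blast
          then have "initial (restr x k) y" using s(3) initial_prefix by blast
          then have "restr y k = restr x k" unfolding initial_def by simp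
          then show False using k s(2-4) False by blast
        qed
      next
        case (step A t)
        then obtain a where "a \<in> A" using U(1) by (metis ex_in_conv finite.emptyI)
        then have "\<not> prefix (restr x k) (t @ [a])" using step by blast
        then show ?case by simp
      qed
      moreover have "prefix (restr x k) (restr x j)" using j by (metis initial_comparable initial_restr length_restr)
      ultimately show ?thesis unfolding Y_def using False by blast
    qed
    then show ?thesis by blast
  qed
  ultimately show thesis using that by blast
qed

section \<open>Thinning a tree until a continuous function is almost injective\<close>

text \<open>
A strictly increasing sequence is chosen whose \<open>k\<close>-th member lies in \<open>D (\<pi> k)\<close>, where \<open>\<pi>\<close> takes
every value infinitely often.
\<close>
lemma disjoint_infinite_refinement:
  fixes D :: "'a :: countable \<Rightarrow> nat set"
  obtains E where "\<And>t. E t \<subseteq> D t" "\<And>t. infinite (D t) \<Longrightarrow> infinite (E t)"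
    "\<And>s t. s \<noteq> t \<Longrightarrow> E s \<inter> E t = {}"
proof -
  \<comment> \<open>Finite sets \<open>D t\<close> are replaced by \<open>UNIV\<close> so that the choice never gets stuck.\<close>
  define D' where "D' t = (if infinite (D t) then D t else UNIV)" for t
  define \<pi> where "\<pi> k = (from_nat (fst (prod_decode k)) :: 'a)" for k
  have ex: "\<exists>d'. d' \<in> D' (\<pi> k) \<and> d < d'" for k d
    unfolding D'_def by (auto simp: infinite_nat_iff_unbounded)
  obtain d where d: "\<And>k. d k \<in> D' (\<pi> k) \<and> d k < d (Suc k)"
    using dependent_nat_choice[of "\<lambda>k x. x \<in> D' (\<pi> k)" "\<lambda>k x y. x < y"] ex by blast
  then have mono: "strict_mono d" by (simp add: strict_mono_Suc_iff)
  define E where "E t = (if infinite (D t) then d ` {k. \<pi> k = t} else {})" for t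
  show thesis
  proof
    show "E t \<subseteq> D t" for t
    proof (cases "infinite (D t)")
      case True
      then have "d k \<in> D t" if "\<pi> k = t" for k using d[of k] that unfolding D'_def by simp
      then show ?thesis using True unfolding E_def by auto
    qed (simp add: E_def)
    show "infinite (E t)" if "infinite (D t)" for t
    proof -
      have "range (\<lambda>i. prod_encode (to_nat t, i)) \<subseteq> {k. \<pi> k = t}" unfolding \<pi>_def by auto
      moreover have "infinite (range (\<lambda>i. prod_encode (to_nat t, i)))"
        by (intro range_inj_infinite) (auto intro: injI)
      ultimately have "infinite {k. \<pi> k = t}" using finite_subset by blast
      then show ?thesis unfolding E_def using that mono
        by (simp add: finite_image_iff strict_mono_imp_inj_on inj_on_subset)
    qed
    show "E s \<inter> E t = {}" if "s \<noteq> t" for s t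
      using that strict_mono_eq[OF mono] unfolding E_def by auto
  qed
qed

text \<open>
Call an edge \<open>(t, a)\<close> a jump if the label changes along it, and let \<open>\<Delta> t a\<close> be the first place
where it changes. The successors of \<open>t\<close> are thinned so that either no edge above \<open>t\<close> is a jump or
all are. In the second case \<open>\<Delta>\<close> is unbounded on the edges above \<open>t\<close>, and further thinning
arranges that \<open>\<Delta>\<close> grows along branches and is injective on all jumps of the tree, not only on those
at a single node. If the limit \<open>y\<close> of the labels along a branch \<open>x\<close> is not itself a label, then
jumps occur cofinally on \<open>x\<close>. Above any node \<open>t\<close> of \<open>x\<close>, the first jump on \<open>x\<close> has for its \<open>\<Delta>\<close>
the first place where \<open>y\<close> differs from \<open>Y t\<close>, as later jumps change only later places. Two branches
with the same limit \<open>y\<close> that part at \<open>t\<close> would hence make the same first jump after \<open>t\<close>, which is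
impossible.
\<close>
lemma limits_determine_branches:
  fixes Y :: "nat list \<Rightarrow> nat \<Rightarrow> bool"
  assumes Y: "\<And>t m. infinite {a. \<forall>n<m. Y (t @ [a]) n = Y t n}"
  obtains Q where "Q \<in> complete_laver_trees"
    "\<And>x x' y. \<lbrakk>x \<in> body Q; x' \<in> body Q; y \<notin> range Y;
       \<And>n. \<exists>k. \<forall>j\<ge>k. Y (restr x j) n = y n; \<And>n. \<exists>k. \<forall>j\<ge>k. Y (restr x' j) n = y n\<rbrakk> \<Longrightarrow> x = x'"
proof -
  define jump where "jump t a \<longleftrightarrow> Y (t @ [a]) \<noteq> Y t" for t a
  define \<Delta> where "\<Delta> t a = (LEAST n. Y (t @ [a]) n \<noteq> Y t n)" for t a
  have \<Delta>: "Y (t @ [a]) (\<Delta> t a) \<noteq> Y t (\<Delta> t a)" if "jump t a" for t a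
  proof -
    have "\<exists>n. Y (t @ [a]) n \<noteq> Y t n" using that unfolding jump_def by blast
    then show ?thesis unfolding \<Delta>_def by (rule LeastI_ex)
  qed
  have below_\<Delta>: "Y (t @ [a]) n = Y t n" if "n < \<Delta> t a" for t a n
    using that not_less_Least unfolding \<Delta>_def by blast
  \<comment> \<open>exceeds \<open>\<Delta>\<close> on all edges leading to \<open>t\<close>\<close>
  define bound where "bound t = (\<Sum>i<length t. Suc (\<Delta> (take i t) (t ! i)))" for t
  have bound: "\<Delta> (restr x i) (x i) < bound (restr x j)" if "i < j" for x i j
  proof -
    have "Suc (\<Delta> (restr x i) (x i)) = Suc (\<Delta> (take i (restr x j)) (restr x j ! i))"
      using that by (simp add: min_absorb1)
    also have "\<dots> \<le> bound (restr x j)" unfolding bound_def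
      by (rule member_le_sum) (use that in auto)
    finally show ?thesis by simp
  qed
  define D where "D t = {d. \<exists>a. jump t a \<and> \<Delta> t a = d \<and> bound t \<le> d}" for t
  have infD: "infinite (D t)" if "finite {a. \<not> jump t a}" for t
  proof -
    have "\<exists>d>m. d \<in> D t" for m
    proof -
      have "infinite ({a. \<forall>n<Suc (m + bound t). Y (t @ [a]) n = Y t n} - {a. \<not> jump t a})"
        using Y that by (rule Diff_infinite_finite[rotated])
      then obtain a where a: "\<forall>n<Suc (m + bound t). Y (t @ [a]) n = Y t n" "jump t a"
        using infinite_imp_nonempty by blast
      then have "Suc (m + bound t) \<le> \<Delta> t a" using \<Delta> by (meson not_less)
      then show ?thesis using a(2) unfolding D_def by (intro exI[of _ "\<Delta> t a"]) auto
    qed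
    then show ?thesis by (simp add: infinite_nat_iff_unbounded)
  qed
  obtain E where E: "\<And>t. E t \<subseteq> D t" "\<And>t. infinite (D t) \<Longrightarrow> infinite (E t)"
    "\<And>s t. s \<noteq> t \<Longrightarrow> E s \<inter> E t = {}" using disjoint_infinite_refinement[of D] by blast
  \<comment> \<open>One edge is kept for each value of \<open>\<Delta>\<close>; disjointness of the sets \<open>E t\<close> handles different nodes.\<close>
  define A where "A t = (if finite {a. \<not> jump t a}
     then {a. jump t a \<and> \<Delta> t a \<in> E t \<and> a = (LEAST b. jump t b \<and> \<Delta> t b = \<Delta> t a)}
     else {a. \<not> jump t a})" for t
  have infA: "infinite (A t)" for t
  proof (cases "finite {a. \<not> jump t a}")
    case True
    have "E t \<subseteq> \<Delta> t ` A t"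
    proof
      fix d assume d: "d \<in> E t"
      then obtain a where "jump t a \<and> \<Delta> t a = d" using E(1) unfolding D_def by blast
      then have "jump t (LEAST b. jump t b \<and> \<Delta> t b = d) \<and> \<Delta> t (LEAST b. jump t b \<and> \<Delta> t b = d) = d"
        by (rule LeastI)
      then show "d \<in> \<Delta> t ` A t" using d True unfolding A_def
        by (intro image_eqI[of _ _ "LEAST b. jump t b \<and> \<Delta> t b = d"]) auto
    qed
    then show ?thesis using E(2) infD True by (meson finite_imageI finite_subset)
  qed (auto simp: A_def)
  have A_jump: "\<Delta> t a \<in> E t" "a = (LEAST b. jump t b \<and> \<Delta> t b = \<Delta> t a)" "bound t \<le> \<Delta> t a"
    if "a \<in> A t" "jump t a" for t a
    using that E(1)[of t] unfolding A_def D_def by (auto split: if_splits)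
  have A_inj: "t = s \<and> a = b"
    if "a \<in> A t" "jump t a" "b \<in> A s" "jump s b" "\<Delta> t a = \<Delta> s b" for t s a b
  proof -
    have "t = s" using A_jump(1)[of a t] A_jump(1)[of b s] that E(3)[of t s] by auto
    then show ?thesis using A_jump(2)[of a t] A_jump(2)[of b s] that by simp
  qed
  define Q where "Q = {t. \<forall>i<length t. t ! i \<in> A (take i t)}"
  have "is_tree Q" unfolding is_tree_def
  proof (intro conjI ballI allI impI)
    show "Q \<noteq> {}" unfolding Q_def by (auto intro: exI[of _ "[]"])
    fix t s assume t: "t \<in> Q" and "prefix s t"
    then obtain r where r: "t = s @ r" by (auto simp: prefix_def)
    show "s \<in> Q" unfolding Q_def
    proof (intro CollectI allI impI)
      fix i assume "i < length s"
      then show "s ! i \<in> A (take i s)" using t r unfolding Q_def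
        by (auto simp: nth_append dest!: spec[of _ i])
    qed
  qed
  moreover have "succs Q t = A t" if "t \<in> Q" for t
    using that unfolding succs_def Q_def by (auto simp: nth_append less_Suc_eq)
  ultimately have QC: "Q \<in> complete_laver_trees" using infA by (simp add: complete_laver_iff)
  have branch: "x k \<in> A (restr x k)" if x: "x \<in> body Q" for x k
  proof -
    have "restr x (Suc k) \<in> Q" using x unfolding body_def by blast
    then show ?thesis unfolding Q_def by (auto dest!: spec[of _ k])
  qed
  have first_jump: "\<exists>j\<ge>k. jump (restr x j) (x j) \<and> y (\<Delta> (restr x j) (x j)) \<noteq> Y (restr x k) (\<Delta> (restr x j) (x j))
      \<and> (\<forall>n<\<Delta> (restr x j) (x j). y n = Y (restr x k) n)"
    if x: "x \<in> body Q" and y: "y \<notin> range Y" and lim: "\<And>n. \<exists>k. \<forall>j\<ge>k. Y (restr x j) n = y n" for x y k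
  proof -
    have ex: "\<exists>j. jump (restr x (k + j)) (x (k + j))"
    proof (rule ccontr)
      assume "\<nexists>j. jump (restr x (k + j)) (x (k + j))"
      then have st: "Y (restr x (Suc (k + j))) = Y (restr x (k + j))" for j
        unfolding jump_def by (simp add: restr_Suc)
      have const: "Y (restr x (k + j)) = Y (restr x k)" for j
        by (induction j) (use st in auto)
      have "y n = Y (restr x k) n" for n
      proof -
        obtain k' where "\<forall>j\<ge>k'. Y (restr x j) n = y n" using lim by blast
        then have "Y (restr x (k + k')) n = y n" by simp
        then show ?thesis using const by simp
      qed
      then show False using y by blast
    qed
    define i where "i = (LEAST j. jump (restr x (k + j)) (x (k + j)))"
    define j where "j = k + i"
    have jump: "jump (restr x j) (x j)" unfolding j_def i_def by (rule LeastI_ex[OF ex])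
    have "Y (restr x (k + l)) = Y (restr x k)" if "l \<le> i" for l
      using that
    proof (induction l)
      case (Suc l)
      then have "\<not> jump (restr x (k + l)) (x (k + l))"
        using not_less_Least[of l] unfolding i_def by (meson Suc_le_lessD)
      then show ?case using Suc unfolding jump_def by (simp add: restr_Suc)
    qed simp
    then have const: "Y (restr x j) = Y (restr x k)" unfolding j_def by blast
    let ?d = "\<Delta> (restr x j) (x j)"
    have stable: "Y (restr x (Suc j + l)) n = Y (restr x (Suc j)) n" if n: "n \<le> ?d" for n l
    proof (induction l)
      case (Suc l)
      let ?t = "restr x (Suc j + l)" and ?a = "x (Suc j + l)"
      have "Y (?t @ [?a]) n = Y ?t n"
      proof (cases "jump ?t ?a")
        case True
        have "?d < bound ?t" by (rule bound) simp
        also have "\<dots> \<le> \<Delta> ?t ?a" using A_jump(3) branch[OF x] True by blast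
        finally show ?thesis using n below_\<Delta> by simp
      qed (simp add: jump_def)
      then show ?case using Suc by (simp add: restr_Suc)
    qed simp
    have y_eq: "y n = Y (restr x (Suc j)) n" if n: "n \<le> ?d" for n
    proof -
      obtain k' where "\<forall>j\<ge>k'. Y (restr x j) n = y n" using lim by blast
      then have "Y (restr x (Suc j + k')) n = y n" by simp
      then show ?thesis using stable[OF n] by simp
    qed
    have "y ?d \<noteq> Y (restr x k) ?d" using y_eq[of ?d] \<Delta>[OF jump] const by (simp add: restr_Suc)
    moreover have "\<forall>n<?d. y n = Y (restr x k) n" using y_eq below_\<Delta> const by (simp add: restr_Suc)
    moreover have "j \<ge> k" unfolding j_def by simp
    ultimately show ?thesis using jump by blast
  qed
  have "x = x'" if x: "x \<in> body Q" "x' \<in> body Q" and y: "y \<notin> range Y"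
    and lim: "\<And>n. \<exists>k. \<forall>j\<ge>k. Y (restr x j) n = y n" "\<And>n. \<exists>k. \<forall>j\<ge>k. Y (restr x' j) n = y n" for x x' y
  proof (rule ccontr)
    assume "x \<noteq> x'"
    then have ex: "\<exists>n. x n \<noteq> x' n" by blast
    define k where "k = (LEAST n. x n \<noteq> x' n)"
    have k: "x k \<noteq> x' k" unfolding k_def by (rule LeastI_ex[OF ex])
    have "x i = x' i" if "i < k" for i using not_less_Least that unfolding k_def by blast
    then have eq: "restr x k = restr x' k" by (intro nth_equalityI) auto
    obtain j where j: "j \<ge> k" "jump (restr x j) (x j)"
      "y (\<Delta> (restr x j) (x j)) \<noteq> Y (restr x k) (\<Delta> (restr x j) (x j))"
      "\<forall>n<\<Delta> (restr x j) (x j). y n = Y (restr x k) n" using first_jump[OF x(1) y lim(1)] by blast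
    obtain j' where j': "j' \<ge> k" "jump (restr x' j') (x' j')"
      "y (\<Delta> (restr x' j') (x' j')) \<noteq> Y (restr x k) (\<Delta> (restr x' j') (x' j'))"
      "\<forall>n<\<Delta> (restr x' j') (x' j'). y n = Y (restr x k) n" using first_jump[OF x(2) y lim(2), of k] eq by auto
    have "\<Delta> (restr x j) (x j) = \<Delta> (restr x' j') (x' j')"
      using j(3,4) j'(3,4) by (metis linorder_neqE_nat)
    then have "restr x j = restr x' j'" "x j = x' j'"
      using A_inj[OF branch[OF x(1)] j(2) branch[OF x(2)] j'(2)] by blast+
    then have "restr x (Suc j) = restr x' (Suc j)" by (metis length_restr restr_Suc)
    then show False using k j(1) restr_eq_nth by (metis le_imp_less_Suc)
  qed
  then show thesis using that QC by blast
qed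

text \<open>
The exceptional set consists of the labels: there are only countably many, one for each node.
\<close>
lemma injective_off_countable:
  fixes g :: "baire \<Rightarrow> nat \<Rightarrow> bool"
  assumes "\<And>x n. x \<in> X \<Longrightarrow> \<exists>k. \<forall>x'\<in>X. restr x' k = restr x k \<longrightarrow> g x' n = g x n"
  obtains Q C where "Q \<in> complete_laver_trees" "countable C"
    "inj_on g {x \<in> body Q \<inter> X. g x \<notin> C}"
proof -
  obtain Y :: "nat list \<Rightarrow> nat \<Rightarrow> bool" where
    Y: "\<And>t m. infinite {a. \<forall>n<m. Y (t @ [a]) n = Y t n}"
    and lim: "\<And>x n. x \<in> X \<Longrightarrow> \<exists>k. \<forall>j\<ge>k. Y (restr x j) n = g x n"
    using exists_limit_labels[of X g] assms by blast
  obtain Q where Q: "Q \<in> complete_laver_trees" and det: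
    "\<And>x x' y. \<lbrakk>x \<in> body Q; x' \<in> body Q; y \<notin> range Y;
       \<And>n. \<exists>k. \<forall>j\<ge>k. Y (restr x j) n = y n; \<And>n. \<exists>k. \<forall>j\<ge>k. Y (restr x' j) n = y n\<rbrakk> \<Longrightarrow> x = x'"
    using limits_determine_branches[OF Y] by blast
  have "inj_on g {x \<in> body Q \<inter> X. g x \<notin> range Y}"
  proof (rule inj_onI)
    fix x x' assume "x \<in> {x \<in> body Q \<inter> X. g x \<notin> range Y}" "x' \<in> {x \<in> body Q \<inter> X. g x \<notin> range Y}"
      and "g x = g x'"
    then show "x = x'" using det[of x x' "g x"] lim[of x] lim[of x'] by auto
  qed
  then show thesis using that[OF Q, of "range Y"] by simp
qed

section \<open>Sets of cardinality less than the continuum\<close>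

definition small :: "'a set \<Rightarrow> bool" where
  "small A \<longleftrightarrow> \<not> (UNIV :: (nat \<Rightarrow> bool) set) \<lesssim> A"

lemma small_iff_ordLess: "small A \<longleftrightarrow> (card_of A, card_of (UNIV :: (nat \<Rightarrow> bool) set)) \<in> ordLess"
  unfolding small_def lepoll_def card_of_ordLeq
  by (rule not_ordLeq_iff_ordLess) (rule card_of_Well_order)+

lemma small_lepoll: "A \<lesssim> B \<Longrightarrow> small B \<Longrightarrow> small A"
  unfolding small_def using lepoll_trans by blast

lemma small_countable:
  assumes "countable A"
  shows "small A"
proof -
  have "uncountable (UNIV :: (nat \<Rightarrow> bool) set)"
  proof
    assume "countable (UNIV :: (nat \<Rightarrow> bool) set)"
    then obtain f :: "nat \<Rightarrow> nat \<Rightarrow> bool" where "range f = UNIV"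
      using uncountable_def by blast
    then obtain n where "f n = (\<lambda>k. \<not> f k k)" by (metis surjD)
    then show False by (metis (full_types))
  qed
  then show ?thesis using assms countable_lepoll unfolding small_def by blast
qed

lemma small_Un:
  assumes "small A" "small B"
  shows "small (A \<union> B)"
proof -
  have "infinite (UNIV :: (nat \<Rightarrow> bool) set)"
    using small_countable countable_finite small_def by blast
  then show ?thesis using assms card_of_Un_ordLess_infinite unfolding small_iff_ordLess by blast
qed

text \<open>
A well-order of least possible type has only initial segments of smaller cardinality.
\<close>
lemma exists_well_order_small_segments:
  obtains before :: "(nat \<Rightarrow> bool) \<Rightarrow> (nat \<Rightarrow> bool) \<Rightarrow> bool"
  where "\<And>z. small {w. before w z}" "\<And>w z. before w z \<or> w = z \<or> before z w"
proof -
  let ?r = "card_of (UNIV :: (nat \<Rightarrow> bool) set)"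
  have "small {w. w \<in> underS ?r z}" for z
    using card_of_underS[OF card_of_Card_order, of z UNIV]
    unfolding small_iff_ordLess by (simp add: Field_card_of)
  moreover have "w \<in> underS ?r z \<or> w = z \<or> z \<in> underS ?r w" for w z
    using card_of_well_order_on[of "UNIV :: (nat \<Rightarrow> bool) set"]
    unfolding well_order_on_def linear_order_on_def total_on_def underS_def by auto
  ultimately show thesis by (rule that[of "\<lambda>w z. w \<in> underS ?r z"])
qed

lemma baire_lepoll: "(L :: baire set) \<lesssim> (UNIV :: (nat \<Rightarrow> bool) set)"
proof -
  have "inj (\<lambda>(x :: baire) k. x (fst (prod_decode k)) = snd (prod_decode k))"
  proof (rule injI, rule ext)
    fix x y :: baire and n
    assume "(\<lambda>k. x (fst (prod_decode k)) = snd (prod_decode k))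
      = (\<lambda>k. y (fst (prod_decode k)) = snd (prod_decode k))"
    from fun_cong[OF this, of "prod_encode (n, x n)"] show "x n = y n" by simp
  qed
  then show ?thesis unfolding lepoll_def by (meson inj_on_subset subset_UNIV)
qed

section \<open>Continuum many disjoint trees\<close>

definition parity_tree :: "(nat \<Rightarrow> bool) \<Rightarrow> nodes" where
  "parity_tree z = {t. \<forall>i<length t. even (t ! i) = z i}"

lemma parity_tree_complete_laver: "parity_tree z \<in> complete_laver_trees"
  unfolding complete_laver_iff
proof (intro conjI ballI)
  show "is_tree (parity_tree z)" unfolding is_tree_def
  proof (intro conjI ballI allI impI)
    show "parity_tree z \<noteq> {}" unfolding parity_tree_def by (auto intro: exI[of _ "[]"])
    fix t s assume t: "t \<in> parity_tree z" and "prefix s t"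
    then obtain r where r: "t = s @ r" by (auto simp: prefix_def)
    show "s \<in> parity_tree z" unfolding parity_tree_def
    proof (intro CollectI allI impI)
      fix i assume "i < length s"
      then show "even (s ! i) = z i" using t r unfolding parity_tree_def
        by (auto simp: nth_append dest!: spec[of _ i])
    qed
  qed
  fix t assume t: "t \<in> parity_tree z"
  have "range (\<lambda>k. 2 * k + (if z (length t) then 0 else 1)) \<subseteq> succs (parity_tree z) t"
    using t unfolding succs_def parity_tree_def by (auto simp: nth_append less_Suc_eq)
  moreover have "infinite (range (\<lambda>k. 2 * k + (if z (length t) then 0 else 1 :: nat)))"
    by (intro range_inj_infinite injI) simp
  ultimately show "infinite (succs (parity_tree z) t)" using finite_subset by blast
qed

definition parity :: "baire \<Rightarrow> nat \<Rightarrow> bool" where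
  "parity x = (\<lambda>n. even (x n))"

lemma parity_body:
  assumes "x \<in> body (parity_tree z)"
  shows "parity x = z"
proof
  fix n
  have "restr x (Suc n) \<in> parity_tree z" using assms unfolding body_def by blast
  then show "parity x n = z n" unfolding parity_tree_def parity_def by (auto dest: spec[of _ n])
qed

lemma contains_imagesE:
  assumes "contains_images \<T>" "P \<in> \<T>"
  obtains \<phi> e where "tree_embedding \<phi> e"
    "\<And>Q. Q \<in> complete_laver_trees \<Longrightarrow> image_tree \<phi> Q \<in> \<T>"
    "\<And>Q. Q \<in> complete_laver_trees \<Longrightarrow> image_tree \<phi> Q \<subseteq> P"
    "\<And>Q. Q \<in> complete_laver_trees \<Longrightarrow> body (image_tree \<phi> Q) \<subseteq> branch_map \<phi> ` body Q"
proof -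
  obtain \<phi> e where E: "tree_embedding \<phi> e" and
    "\<forall>Q\<in>complete_laver_trees. image_tree \<phi> Q \<in> \<T> \<and> image_tree \<phi> Q \<subseteq> P"
    using assms unfolding contains_images_def by blast
  moreover have "body (image_tree \<phi> Q) \<subseteq> branch_map \<phi> ` body Q" if "Q \<in> complete_laver_trees" for Q
    using body_image_tree[OF E] that unfolding complete_laver_iff by blast
  ultimately show thesis using that by blast
qed

text \<open>
The copies of the parity trees below \<open>P\<close> have pairwise disjoint bodies, and there are continuum
many of them, so one of them misses \<open>A\<close>.
\<close>
lemma avoid_small:
  assumes "contains_images \<T>" "P \<in> \<T>" "small A"
  obtains Q where "Q \<in> \<T>" "Q \<subseteq> P" "body Q \<inter> A = {}"
proof -
  obtain \<phi> e where E: "tree_embedding \<phi> e" and im: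
    "\<And>Q. Q \<in> complete_laver_trees \<Longrightarrow> image_tree \<phi> Q \<in> \<T>"
    "\<And>Q. Q \<in> complete_laver_trees \<Longrightarrow> image_tree \<phi> Q \<subseteq> P"
    "\<And>Q. Q \<in> complete_laver_trees \<Longrightarrow> body (image_tree \<phi> Q) \<subseteq> branch_map \<phi> ` body Q"
    using contains_imagesE[OF assms(1,2)] by blast
  have "\<exists>z. body (image_tree \<phi> (parity_tree z)) \<inter> A = {}"
  proof (rule ccontr)
    assume "\<nexists>z. body (image_tree \<phi> (parity_tree z)) \<inter> A = {}"
    then have "\<forall>z. \<exists>x. x \<in> body (parity_tree z) \<and> branch_map \<phi> x \<in> A"
      using im(3)[OF parity_tree_complete_laver] by blast
    then obtain x where x: "\<And>z. x z \<in> body (parity_tree z)" "\<And>z. branch_map \<phi> (x z) \<in> A" by metis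
    have "inj (\<lambda>z. branch_map \<phi> (x z))"
      using inj_branch_map[OF E] x(1) parity_body by (intro injI) (metis injD)
    then have "(UNIV :: (nat \<Rightarrow> bool) set) \<lesssim> A" unfolding lepoll_def using x(2) by blast
    then show False using assms(3) unfolding small_def by blast
  qed
  then show thesis using that im parity_tree_complete_laver by blast
qed

section \<open>Large null subsets\<close>

text \<open>
If \<open>L\<close> is not null, there is \<open>P\<close> below which every tree meets \<open>L\<close>, and by
\<open>avoid_small\<close> every tree below \<open>P\<close> even meets it in continuum many points; in particular each of
the disjoint copies of parity trees does, whose bodies are the sets \<open>F z\<close>. The set sought contains
one point \<open>x z\<close> of each \<open>F z \<inter> L\<close>.

To make it null, every tree \<open>R\<close> is first thinned to one whose body has at most one point in \<open>F z\<close>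
for all but countably many \<open>z\<close>; this is \<open>injective_off_countable\<close> for the colour \<open>z\<close>, as a function
on \<open>R\<close>. All trees are listed along a well-order of length the continuum. The point \<open>x z\<close> has to
avoid fewer than continuum many single points, contributed by the thinned trees that come before
\<open>z\<close>. The thinned tree with index \<open>w\<close> then contains \<open>x z\<close> only if \<open>z\<close> does not come after \<open>w\<close> or is
exceptional for \<open>w\<close>, and these few points are avoided by a smaller tree.
\<close>
lemma exists_large_null_subset:
  assumes T: "contains_images \<T>" and L: "L \<notin> tree_null \<T>"
  obtains A where "A \<subseteq> L" "A \<in> tree_null \<T>" "\<not> small A"
proof -
  obtain P where P: "P \<in> \<T>" and meets: "\<And>Q. Q \<in> \<T> \<Longrightarrow> Q \<subseteq> P \<Longrightarrow> body Q \<inter> L \<noteq> {}"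
    using L unfolding tree_null_def by blast
  have large: "\<not> small (body Q \<inter> L)" if Q: "Q \<in> \<T>" "Q \<subseteq> P" for Q
  proof
    assume "small (body Q \<inter> L)"
    then obtain Q' where Q': "Q' \<in> \<T>" "Q' \<subseteq> Q" "body Q' \<inter> (body Q \<inter> L) = {}"
      using avoid_small[OF T Q(1)] by blast
    then have "body Q' \<inter> L = {}" unfolding body_def by blast
    then show False using meets Q' Q(2) by blast
  qed
  obtain \<phi> e where E: "tree_embedding \<phi> e" and im:
    "\<And>Q. Q \<in> complete_laver_trees \<Longrightarrow> image_tree \<phi> Q \<in> \<T>"
    "\<And>Q. Q \<in> complete_laver_trees \<Longrightarrow> image_tree \<phi> Q \<subseteq> P"
    "\<And>Q. Q \<in> complete_laver_trees \<Longrightarrow> body (image_tree \<phi> Q) \<subseteq> branch_map \<phi> ` body Q"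
    using contains_imagesE[OF T P] by blast
  define F where "F z = body (image_tree \<phi> (parity_tree z))" for z
  \<comment> \<open>meaningful only on the range of \<open>branch_map \<phi>\<close>, which contains all sets \<open>F z\<close>\<close>
  define colour where "colour x = parity (inv (branch_map \<phi>) x)" for x
  have inv: "inv (branch_map \<phi>) (branch_map \<phi> x) = x" for x
    using inj_branch_map[OF E] by (rule inv_f_f)
  have F: "x \<in> range (branch_map \<phi>)" "colour x = z" if "x \<in> F z" for x z
    using that im(3)[OF parity_tree_complete_laver] parity_body inv unfolding F_def colour_def by fastforce+
  have F_large: "\<not> small (F z \<inter> L)" for z
    using large im parity_tree_complete_laver unfolding F_def by blast
  define single where "single Q C \<longleftrightarrow> (\<forall>z x x'. z \<notin> C \<and> x \<in> F z \<inter> body Q \<and> x' \<in> F z \<inter> body Q \<longrightarrow> x = x')"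
    for Q C
  have thin: "\<exists>Q C. R \<in> \<T> \<longrightarrow> Q \<in> \<T> \<and> Q \<subseteq> R \<and> countable C \<and> single Q C" for R
  proof (cases "R \<in> \<T>")
    case True
    obtain \<psi> d where D: "tree_embedding \<psi> d" and imR:
      "\<And>Q. Q \<in> complete_laver_trees \<Longrightarrow> image_tree \<psi> Q \<in> \<T>"
      "\<And>Q. Q \<in> complete_laver_trees \<Longrightarrow> image_tree \<psi> Q \<subseteq> R"
      "\<And>Q. Q \<in> complete_laver_trees \<Longrightarrow> body (image_tree \<psi> Q) \<subseteq> branch_map \<psi> ` body Q"
      using contains_imagesE[OF T True] by blast
    define X where "X = {x. branch_map \<psi> x \<in> range (branch_map \<phi>)}"
    define g where "g x = colour (branch_map \<psi> x)" for x
    have "\<exists>k. \<forall>x'\<in>X. restr x' k = restr x k \<longrightarrow> g x' n = g x n" if "x \<in> X" for x n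
    proof -
      obtain u where u: "branch_map \<psi> x = branch_map \<phi> u" using \<open>x \<in> X\<close> unfolding X_def by blast
      \<comment> \<open>a piece of \<open>branch_map \<psi> x\<close> that decides \<open>u n\<close>, hence the bit \<open>n\<close> of its colour\<close>
      let ?s = "\<phi> (restr u (Suc n))"
      have "g x' n = g x n" if x': "x' \<in> X" "restr x' (length ?s) = restr x (length ?s)" for x'
      proof -
        obtain u' where u': "branch_map \<psi> x' = branch_map \<phi> u'" using x'(1) unfolding X_def by blast
        have "restr (branch_map \<psi> x) (length ?s) = restr (branch_map \<psi> x') (length ?s)"
          using branch_map_continuous[OF D] x'(2) by metis
        then have "initial ?s (branch_map \<phi> u')"
          using initial_branch_map[OF E, of u "Suc n"] u u' unfolding initial_def by simp
        then have "initial (restr u (Suc n)) u'" using initial_branch_map_iff[OF E] by blast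
        then have "u' n = u n" using initial_nth[of _ u' n] by simp
        then show ?thesis unfolding g_def colour_def u u' inv parity_def by simp
      qed
      then show ?thesis by blast
    qed
    then obtain Q C where Q: "Q \<in> complete_laver_trees" and C: "countable C"
      and inj: "inj_on g {x \<in> body Q \<inter> X. g x \<notin> C}"
      using injective_off_countable[of X g] by blast
    have "x = x'" if xx: "z \<notin> C" "x \<in> F z \<inter> body (image_tree \<psi> Q)" "x' \<in> F z \<inter> body (image_tree \<psi> Q)" for z x x'
    proof -
      obtain v v' where v: "v \<in> body Q" "x = branch_map \<psi> v" "v' \<in> body Q" "x' = branch_map \<psi> v'"
        using xx imR(3)[OF Q] by blast
      then have "v \<in> X" "v' \<in> X" "g v = z" "g v' = z" using F that unfolding X_def g_def by auto
      then have "v = v'" using inj_onD[OF inj, of v v'] v that(1) by simp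
      then show ?thesis using v by simp
    qed
    then have "single (image_tree \<psi> Q) C" unfolding single_def by blast
    then show ?thesis using imR(1,2)[OF Q] C by (intro exI[of _ "image_tree \<psi> Q"] exI[of _ C] impI conjI)
  qed simp
  \<comment> \<open>a coding of all sets of nodes by the points of \<open>2\<^sup>\<omega>\<close>, so that both the trees and the sets
      \<open>F z\<close> are indexed by the same well-order\<close>
  define tree where "tree w = {t :: nat list. w (to_nat t)}" for w
  have surj: "\<exists>w. tree w = R" for R
  proof -
    have "tree (\<lambda>n. from_nat n \<in> R) = R" unfolding tree_def by simp
    then show ?thesis by blast
  qed
  have "\<forall>w. \<exists>Q C. tree w \<in> \<T> \<longrightarrow> Q \<in> \<T> \<and> Q \<subseteq> tree w \<and> countable C \<and> single Q C"
    using thin by simp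
  then obtain Q C where
    QC: "\<And>w. tree w \<in> \<T> \<Longrightarrow> Q w \<in> \<T> \<and> Q w \<subseteq> tree w \<and> countable (C w) \<and> single (Q w) (C w)"
    by metis
  have Q: "Q w \<in> \<T>" "Q w \<subseteq> tree w" and C: "countable (C w)" if "tree w \<in> \<T>" for w
    using QC[OF that] by simp_all
  have one: "x = x'"
    if "tree w \<in> \<T>" "z \<notin> C w" "x \<in> F z \<inter> body (Q w)" "x' \<in> F z \<inter> body (Q w)" for w z x x'
    using QC[OF that(1)] that(2-4) unfolding single_def by blast
  obtain before :: "(nat \<Rightarrow> bool) \<Rightarrow> (nat \<Rightarrow> bool) \<Rightarrow> bool"
    where seg: "\<And>z. small {w. before w z}" and total: "\<And>w z. before w z \<or> w = z \<or> before z w"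
    using exists_well_order_small_segments by blast
  have "\<exists>x. x \<in> F z \<inter> L \<and> (\<forall>w. before w z \<and> tree w \<in> \<T> \<and> z \<notin> C w \<longrightarrow> x \<notin> body (Q w))" for z
  proof (rule ccontr)
    assume no: "\<nexists>x. x \<in> F z \<inter> L \<and> (\<forall>w. before w z \<and> tree w \<in> \<T> \<and> z \<notin> C w \<longrightarrow> x \<notin> body (Q w))"
    have "F z \<inter> L \<lesssim> {w. before w z}"
    proof (rule lepoll_relational_full[where R = "\<lambda>w x. tree w \<in> \<T> \<and> z \<notin> C w \<and> x \<in> body (Q w)"])
      show "\<exists>w. w \<in> {w. before w z} \<and> tree w \<in> \<T> \<and> z \<notin> C w \<and> x \<in> body (Q w)" if "x \<in> F z \<inter> L" for x
        using no that by blast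
    qed (use one in blast)
    then show False using F_large seg small_lepoll by blast
  qed
  then obtain x where x: "\<And>z. x z \<in> F z \<inter> L"
    and avoid: "\<And>z w. before w z \<Longrightarrow> tree w \<in> \<T> \<Longrightarrow> z \<notin> C w \<Longrightarrow> x z \<notin> body (Q w)" by metis
  have "range x \<in> tree_null \<T>"
    unfolding tree_null_def
  proof (intro CollectI ballI)
    fix R assume R: "R \<in> \<T>"
    obtain w where w: "tree w = R" using surj by blast
    let ?Z = "{z. before z w} \<union> ({w} \<union> C w)"
    have "small ?Z" using C[of w] R w by (intro small_Un seg small_countable) auto
    then have "small (x ` ?Z)" using small_lepoll image_lepoll by blast
    then obtain Q' where Q': "Q' \<in> \<T>" "Q' \<subseteq> Q w" "body Q' \<inter> x ` ?Z = {}"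
      using avoid_small[OF T Q(1)] R w by blast
    have "x z \<notin> body Q'" for z
    proof (cases "z \<in> ?Z")
      case True
      then show ?thesis using Q'(3) by blast
    next
      case False
      then have "x z \<notin> body (Q w)" using avoid[of w z] total[of w z] R w by blast
      then show ?thesis using Q'(2) unfolding body_def by blast
    qed
    then show "\<exists>Q\<in>\<T>. Q \<subseteq> R \<and> body Q \<inter> range x = {}"
      using Q' Q(2)[of w] R w by blast
  qed
  moreover have "\<not> small (range x)"
  proof -
    have "inj x" using x F(2) by (intro injI) (metis IntD1)
    then show ?thesis unfolding small_def lepoll_def by blast
  qed
  ultimately show thesis using that[of "range x"] x by blast
qed

section \<open>Luzin sets\<close>

lemma no_luzin_set:
  assumes "contains_images \<T>"
  shows "\<nexists>L. luzin_set (tree_null \<T>) L"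
proof
  assume "\<exists>L. luzin_set (tree_null \<T>) L"
  then obtain L where L: "\<And>A. A \<in> tree_null \<T> \<Longrightarrow> A \<inter> L \<prec> L" unfolding luzin_set_def by blast
  have "L \<notin> tree_null \<T>" using L[of L] by auto
  then obtain A where A: "A \<subseteq> L" "A \<in> tree_null \<T>" "\<not> small A"
    using exists_large_null_subset[OF assms] by blast
  have "L \<lesssim> A" using A(3) baire_lepoll lepoll_trans unfolding small_def by blast
  moreover have "A \<prec> L" using L[OF A(2)] A(1) by (simp add: Int_absorb2)
  ultimately show False using lesspoll_trans2 by blast
qed

theorem theorem20:
  shows "(\<nexists>L. luzin_set l0 L) \<and> (\<nexists>L. luzin_set cl0 L) \<and> (\<nexists>L. luzin_set m0 L)"
  unfolding l0_def cl0_def m0_def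
  using no_luzin_set contains_images_laver contains_images_complete_laver contains_images_miller by blast

end
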